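(* Let $\alpha>0$, $\beta\in(0,1]$ and $f\in\mathcal S_\alpha$. Define $f_{(\beta)}(s)=f(s^\beta)$, $s>0$. Then $f_{(\beta)}\in\mathcal S_{\alpha\beta}$. In particular, $f_{(\beta)}\in\mathcal S_\beta$ if $f\in\mathcal S_1$.
   Context: $\mathbb R_+=[0,\infty)$. For $\alpha\ge0$, $\mathcal M^+_\alpha(\mathbb R_+)$ is the set of positive Borel measures $\mu$ on $\mathbb R_+$ with $\int_{\mathbb R_+}(1+t)^{-\alpha}\mu(dt)<\infty$, and for $\alpha>0$, $S_\alpha[\mu](z)=\int_{\mathbb R_+}\frac{\mu(dt)}{(z+t)^\alpha}$. For $\alpha>0$, $\mathcal S_\alpha$ is the class of functions $f:(0,\infty)\to[0,\infty)$ of the form $f=a+S_\alpha[\mu]$ with $a\ge0$ and $\mu\in\mathcal M^+_\alpha(\mathbb R_+)$. *)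

theory Defs
  imports "HOL-Analysis.Analysis"
begin

text \<open>Positive Borel measures on \<open>R_+ = [0,\<infinity>)\<close>, represented as Borel measures on the
reals that give no mass to \<open>(-\<infinity>,0)\<close>, satisfying the moment condition
\<open>\<integral> (1+t)^(-\<alpha>) d\<mu> < \<infinity>\<close>.\<close>
definition M_plus :: "real \<Rightarrow> real measure set" where
  "M_plus \<alpha> = {\<mu>. sets \<mu> = sets borel \<and> emeasure \<mu> {..<0} = 0 \<and>
      (\<integral>\<^sup>+ t. ennreal ((1 + t) powr (-\<alpha>)) \<partial>\<mu>) < \<infinity>}"

definition Stieltjes_transform :: "real \<Rightarrow> real measure \<Rightarrow> real \<Rightarrow> real" where
  "Stieltjes_transform \<alpha> \<mu> z = (\<integral> t. (z + t) powr (-\<alpha>) \<partial>\<mu>)"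

definition S_class :: "real \<Rightarrow> (real \<Rightarrow> real) set" where
  "S_class \<alpha> = {f. \<exists>a\<ge>0. \<exists>\<mu>\<in>M_plus \<alpha>. \<forall>z>0. f z = a + Stieltjes_transform \<alpha> \<mu> z}"

end

theory Submission
  imports Defs "HOL-Probability.Probability" "HOL-Real_Asymp.Real_Asymp"
begin

text \<open>Let \<open>X\<close>, \<open>Y\<close> be independent one-sided \<open>\<beta>\<close>-stable variables, \<open>E exp (-uX) = exp (-u^\<beta>)\<close>.
  Integrating \<open>E exp (-v^(1/\<beta>) (s X + t^(1/\<beta>) Y)) = exp (-v (s^\<beta> + t))\<close> against \<open>v^(\<alpha>-1) dv\<close> gives
  \<open>(s^\<beta> + t)^(-\<alpha>) = C E (s X + t^(1/\<beta>) Y)^(-\<alpha> \<beta>)\<close>, an average of kernels of order \<open>\<alpha> \<beta>\<close> in \<open>s\<close>;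
  averaging over \<open>t\<close> against \<open>\<mu>\<close> proves the claim. The stable law is the weak limit of
  \<open>n^(-1/\<beta>)\<close> times a sum of \<open>n\<close> independent Sibuya variables, \<open>E z^N = 1 - (1 - z)^\<beta>\<close>.\<close>

section \<open>Laplace transforms of probability laws on the half-line\<close>

text \<open>The law lives on all reals, with positivity only almost everywhere, so that tightness
  and weak convergence of \<open>real_distribution\<close> apply. The clause
  \<open>0 \<le> L u\<close> keeps the equation faithful, since \<open>ennreal\<close> sends
  negative numbers to 0.\<close>

definition has_laplace :: "real measure \<Rightarrow> (real \<Rightarrow> real) \<Rightarrow> bool" where
  "has_laplace M L \<longleftrightarrow> real_distribution M \<and> (AE x in M. 0 \<le> x) \<and>
     (\<forall>u\<ge>0. 0 \<le> L u \<and> (\<integral>\<^sup>+x. ennreal (exp (- (u * x))) \<partial>M) = ennreal (L u))"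

lemma has_laplaceD:
  assumes "has_laplace M L"
  shows "real_distribution M" "prob_space M" "sets M = sets borel" "space M = UNIV" "AE x in M. 0 \<le> x"
    "0 \<le> u \<Longrightarrow> 0 \<le> L u"
    "0 \<le> u \<Longrightarrow> (\<integral>\<^sup>+x. ennreal (exp (- (u * x))) \<partial>M) = ennreal (L u)"
  using assms
  by (auto simp: has_laplace_def real_distribution_def real_distribution_axioms_def
      dest: sets_eq_imp_space_eq)

lemma has_laplaceI:
  assumes "prob_space M" "sets M = sets borel" "AE x in M. 0 \<le> x"
    "\<And>u. 0 \<le> u \<Longrightarrow> 0 \<le> L u"
    "\<And>u. 0 \<le> u \<Longrightarrow> (\<integral>\<^sup>+x. ennreal (exp (- (u * x))) \<partial>M) = ennreal (L u)"
  shows "has_laplace M L"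
  using assms sets_eq_imp_space_eq[OF assms(2), unfolded space_borel]
  by (auto simp: has_laplace_def real_distribution_def real_distribution_axioms_def)

lemma has_laplace_scale:
  assumes M: "has_laplace M L" and c: "0 \<le> c"
  shows "has_laplace (distr M borel (\<lambda>x. c * x)) (\<lambda>u. L (u * c))"
proof -
  note D = has_laplaceD[OF M]
  interpret prob_space M by fact
  have [measurable_cong]: "sets M = sets borel" by fact
  show ?thesis
  proof (rule has_laplaceI)
    show "AE x in distr M borel (\<lambda>x. c * x). 0 \<le> x"
      using D(5) c by (subst AE_distr_iff) (auto elim!: eventually_mono)
    show "(\<integral>\<^sup>+x. ennreal (exp (- (u * x))) \<partial>distr M borel (\<lambda>x. c * x)) = ennreal (L (u * c))"
      if "0 \<le> u" for u
      using D(7)[of "u * c"] that c by (simp add: nn_integral_distr mult.assoc)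
  qed (use D c in \<open>auto intro!: prob_space_distr\<close>)
qed

lemma has_laplace_mult:
  assumes M: "has_laplace M L" and N: "has_laplace N K"
  shows "has_laplace (distr (M \<Otimes>\<^sub>M N) borel (\<lambda>(x, y). x + y)) (\<lambda>u. L u * K u)"
proof -
  note D = has_laplaceD[OF M] and E = has_laplaceD[OF N]
  interpret M: prob_space M by fact
  interpret N: prob_space N by fact
  interpret pair_prob_space M N ..
  have [measurable_cong]: "sets M = sets borel" "sets N = sets borel" by fact+
  show ?thesis
  proof (rule has_laplaceI)
    have "AE x in M \<Otimes>\<^sub>M N. 0 \<le> fst x + snd x"
    proof (rule AE_pair_measure)
      show "AE x in M. AE y in N. 0 \<le> fst (x, y) + snd (x, y)"
        using D(5)
      proof eventually_elim
        case (elim x)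
        show ?case using E(5) by eventually_elim (use elim in auto)
      qed
    qed measurable
    then show "AE x in distr (M \<Otimes>\<^sub>M N) borel (\<lambda>(x, y). x + y). 0 \<le> x"
      by (subst AE_distr_iff) (auto simp: case_prod_unfold)
    fix u :: real assume u: "0 \<le> u"
    have "(\<integral>\<^sup>+x. ennreal (exp (- (u * x))) \<partial>distr (M \<Otimes>\<^sub>M N) borel (\<lambda>(x, y). x + y))
        = (\<integral>\<^sup>+z. ennreal (exp (- (u * fst z))) * ennreal (exp (- (u * snd z))) \<partial>(M \<Otimes>\<^sub>M N))"
      by (subst nn_integral_distr)
        (auto intro!: nn_integral_cong simp: case_prod_unfold algebra_simps
          simp flip: ennreal_mult exp_add)
    also have "\<dots> = (\<integral>\<^sup>+x. \<integral>\<^sup>+y. ennreal (exp (- (u * x))) * ennreal (exp (- (u * y))) \<partial>N \<partial>M)"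
      by (subst N.nn_integral_fst[symmetric]) auto
    also have "\<dots> = ennreal (L u * K u)"
      using D(6,7)[OF u] E(6,7)[OF u] by (simp add: nn_integral_cmult nn_integral_multc ennreal_mult)
    finally show "(\<integral>\<^sup>+x. ennreal (exp (- (u * x))) \<partial>distr (M \<Otimes>\<^sub>M N) borel (\<lambda>(x, y). x + y))
      = ennreal (L u * K u)" .
  qed (use D E in \<open>auto intro!: prob_space_distr\<close>)
qed

lemma has_laplace_power:
  assumes M: "has_laplace M L"
  shows "\<exists>N. has_laplace N (\<lambda>u. L u ^ n)"
proof (induction n)
  case 0
  have "has_laplace (return borel 0) (\<lambda>u. L u ^ 0)"
    by (rule has_laplaceI) (auto simp: prob_space_return AE_return nn_integral_return)
  then show ?case by blast
next
  case (Suc n)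
  then obtain N where "has_laplace N (\<lambda>u. L u ^ n)" by blast
  from has_laplace_mult[OF M this] show ?case by auto
qed

text \<open>The second form replaces \<open>x\<close> by \<open>max 0 x\<close>, which changes
  nothing almost everywhere but makes the integrand bounded and continuous on the whole line, so
  that it can be a test function for weak convergence.\<close>

lemma has_laplace_integral:
  assumes M: "has_laplace M L" and u: "0 \<le> u"
  shows "(\<integral>x. exp (- (u * x)) \<partial>M) = L u"
    "(\<integral>x. exp (- (u * max 0 x)) \<partial>M) = L u"
proof -
  note D = has_laplaceD[OF M]
  have [measurable_cong]: "sets M = sets borel" by fact
  show 1: "(\<integral>x. exp (- (u * x)) \<partial>M) = L u"
    using D(6,7)[OF u] by (subst integral_eq_nn_integral) auto
  have "(\<integral>x. exp (- (u * max 0 x)) \<partial>M) = (\<integral>x. exp (- (u * x)) \<partial>M)"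
  proof (rule integral_cong_AE)
    show "AE x in M. exp (- (u * max 0 x)) = exp (- (u * x))"
      using D(5) by eventually_elim auto
  qed auto
  with 1 show "(\<integral>x. exp (- (u * max 0 x)) \<partial>M) = L u" by simp
qed

text \<open>A Markov-type bound: beyond \<open>1/d\<close> the integrand is below
  \<open>exp (-1)\<close>, hence \<open>L d\<close> is at most m + (1 - m) exp(-1), with m the mass
  of the interval. Continuity of the transforms at 0 thus controls the tails.\<close>

lemma has_laplace_tail:
  assumes M: "has_laplace M L" and d: "0 < d"
  shows "(1 - exp (-1)) * (1 - measure M {-1<..1/d}) \<le> 1 - L d"
proof -
  note D = has_laplaceD[OF M]
  interpret real_distribution M by fact
  \<comment> \<open>Tightness is phrased with intervals open on the left, so the left end is put
    below 0 to include a possible atom at 0.\<close>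
  define A where "A = {-1<..1/d}"
  have [measurable]: "A \<in> sets borel" by (simp add: A_def)
  have "L d = (\<integral>x. exp (- (d * max 0 x)) \<partial>M)"
    using has_laplace_integral(2)[OF M] d by simp
  also have "\<dots> \<le> (\<integral>x. indicator A x * (1 - exp (-1)) + exp (-1) \<partial>M)"
  proof (rule integral_mono_AE)
    show "integrable M (\<lambda>x. exp (- (d * max 0 x)))"
      by (rule integrable_const_bound[of _ 1]) (use d in auto)
    show "integrable M (\<lambda>x. indicator A x * (1 - exp (-1)) + exp (-1::real))"
      by (rule integrable_const_bound[of _ 1]) (auto simp: indicator_def)
    show "AE x in M. exp (- (d * max 0 x)) \<le> indicator A x * (1 - exp (-1)) + exp (-1)"
      using D(5)
    proof eventually_elim
      case (elim x)
      show ?case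
      proof (cases "x \<in> A")
        case True then show ?thesis using elim d by simp
      next
        case False
        then have "1 < d * x" using elim d by (auto simp: A_def field_simps)
        then show ?thesis using False elim by simp
      qed
    qed
  qed
  also have "\<dots> = measure M A * (1 - exp (-1)) + exp (-1)"
    using prob_space
    by (subst Bochner_Integration.integral_add)
       (auto simp: emeasure_eq_measure space_eq_univ)
  finally show ?thesis unfolding A_def by (simp add: algebra_simps)
qed

text \<open>The continuity theorem for Laplace transforms: \<open>unif\<close> is equicontinuity at
  0 and yields tightness, which provides a weakly convergent subsequence; its limit law has the
  transform \<open>l\<close>.\<close>

lemma has_laplace_limit:
  assumes M: "\<And>n. has_laplace (M n) (L n)"
    and unif: "\<And>\<epsilon>. 0 < \<epsilon> \<Longrightarrow> \<exists>d>0. \<forall>n. 1 - L n d < \<epsilon>"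
    and lim: "\<And>u. 0 \<le> u \<Longrightarrow> (\<lambda>n. L n u) \<longlonglongrightarrow> l u"
  shows "\<exists>N. has_laplace N l"
proof -
  have "tight M"
    unfolding tight_def
  proof (intro conjI allI impI)
    fix n show "real_distribution (M n)" using has_laplaceD(1)[OF M] .
  next
    fix \<epsilon> :: real assume "0 < \<epsilon>"
    then have "0 < (1 - exp (-1)) * \<epsilon>" by simp
    from unif[OF this] obtain d where d: "0 < d" "\<And>n. 1 - L n d < (1 - exp (-1)) * \<epsilon>" by blast
    have "measure (M n) {-1<..1/d} > 1 - \<epsilon>" for n
    proof -
      have "(1 - exp (-1)) * (1 - measure (M n) {-1<..1/d}) < (1 - exp (-1)) * \<epsilon>"
        using has_laplace_tail[OF M d(1)] d(2) by (rule le_less_trans)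
      then show ?thesis by simp
    qed
    moreover have "-1 < 1/d" using d by (smt (verit) divide_pos_pos)
    ultimately show "\<exists>a b. a < b \<and> (\<forall>n. 1 - \<epsilon> < measure (M n) {a<..b})" by blast
  qed
  from tight_imp_convergent_subsubsequence[OF this strict_mono_id] obtain r N where
    r: "strict_mono r" and N: "real_distribution N" and w: "weak_conv_m (M \<circ> id \<circ> r) N"
    by blast
  interpret N: real_distribution N by fact
  have rd: "real_distribution ((M \<circ> id \<circ> r) n)" for n using has_laplaceD(1)[OF M] by simp
  note conv = weak_conv_imp_integral_bdd_continuous_conv[OF rd N w]
  \<comment> \<open>This test function is bounded, continuous, nonnegative and zero exactly on the
    half-line, so its vanishing integral in the limit shows that \<open>N\<close> has no mass below
    0.\<close>
  have "(\<lambda>n. \<integral>x. min 1 (max 0 (- x)) \<partial>((M \<circ> id \<circ> r) n)) \<longlonglongrightarrow> (\<integral>x. min 1 (max 0 (- x)) \<partial>N)"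
    by (rule conv[where B=1]) (auto intro!: continuous_intros)
  moreover have "(\<integral>x. min 1 (max 0 (- x)) \<partial>(M k)) = 0" for k
  proof (rule integral_eq_zero_AE)
    show "AE x in M k. min 1 (max 0 (- x)) = 0"
      using has_laplaceD(5)[OF M] by eventually_elim auto
  qed
  ultimately have "(\<integral>x. min 1 (max 0 (- x)) \<partial>N) = 0" by (simp add: LIMSEQ_const_iff)
  then have "AE x in N. min 1 (max 0 (- x)) = 0"
    by (subst (asm) integral_nonneg_eq_0_iff_AE) (auto intro!: N.integrable_const_bound[of _ 1])
  then have pos: "AE x in N. 0 \<le> x" by eventually_elim (auto simp: min_def max_def split: if_splits)
  have "has_laplace N l"
  proof (rule has_laplaceI)
    fix u :: real assume u: "0 \<le> u"
    have "(\<lambda>n. \<integral>x. exp (- (u * max 0 x)) \<partial>((M \<circ> id \<circ> r) n)) \<longlonglongrightarrow> (\<integral>x. exp (- (u * max 0 x)) \<partial>N)"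
      by (rule conv[where B=1]) (use u in \<open>auto intro!: continuous_intros\<close>)
    then have "(\<lambda>n. L (r n) u) \<longlonglongrightarrow> (\<integral>x. exp (- (u * max 0 x)) \<partial>N)"
      by (simp add: has_laplace_integral(2)[OF M u])
    moreover have "(\<lambda>n. L (r n) u) \<longlonglongrightarrow> l u"
      using LIMSEQ_subseq_LIMSEQ[OF lim[OF u] r] by (simp add: comp_def)
    ultimately have eq: "l u = (\<integral>x. exp (- (u * max 0 x)) \<partial>N)" by (rule LIMSEQ_unique[symmetric])
    show "0 \<le> l u" unfolding eq by simp
    have "(\<integral>\<^sup>+x. ennreal (exp (- (u * x))) \<partial>N) = (\<integral>\<^sup>+x. ennreal (exp (- (u * max 0 x))) \<partial>N)"
    proof (rule nn_integral_cong_AE)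
      show "AE x in N. ennreal (exp (- (u * x))) = ennreal (exp (- (u * max 0 x)))"
        using pos by eventually_elim auto
    qed
    also have "\<dots> = ennreal (l u)"
      unfolding eq by (rule nn_integral_eq_integral)
        (use u in \<open>auto intro!: N.integrable_const_bound[of _ 1]\<close>)
    finally show "(\<integral>\<^sup>+x. ennreal (exp (- (u * x))) \<partial>N) = ennreal (l u)" .
  qed (use pos N.prob_space_axioms in auto)
  then show ?thesis by blast
qed

section \<open>The Sibuya law and the one-sided stable law\<close>

text \<open>Absorption extracts \<beta>/(k+1), and negating the upper index cancels the sign. What
  remains is a product of factors k - i - \<beta> with i < k, each nonnegative because \<beta> \<le>
  1.\<close>

lemma sibuya_coeff_nonneg:
  fixes \<beta> :: real
  assumes "0 < \<beta>" "\<beta> \<le> 1"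
  shows "0 \<le> (-1) ^ k * (\<beta> gchoose Suc k)"
proof -
  have "(-1) ^ k * (\<beta> gchoose Suc k) = (-1) ^ k * (\<beta> * (\<beta> - 1 gchoose k)) / real (Suc k)"
    by (simp flip: gbinomial_absorption)
  also have "\<dots> = \<beta> * (real k - \<beta> gchoose k) / real (Suc k)"
    by (subst gbinomial_negated_upper[of "\<beta> - 1" k]) (simp flip: power_mult_distrib mult.assoc)
  also have "0 \<le> \<dots>"
    unfolding gbinomial_prod_rev using assms
    by (intro divide_nonneg_nonneg mult_nonneg_nonneg prod_nonneg) auto
  finally show ?thesis .
qed

text \<open>The binomial series \<open>1 - (1 - z)^\<beta>\<close> has nonnegative coefficients; they are
  the point masses of the Sibuya distribution, and \<open>z = exp (-u)\<close>.\<close>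
lemma has_laplace_sibuya:
  fixes \<beta> :: real
  assumes \<beta>: "0 < \<beta>" "\<beta> \<le> 1"
  shows "\<exists>M. has_laplace M (\<lambda>u. 1 - (1 - exp (- u)) powr \<beta>)"
proof -
  \<comment> \<open>The constant term 1 of (1 - z)^\<beta> cancels, hence \<open>p 0 = 0\<close>;
    the remaining coefficients change sign.\<close>
  define p where "p k = (if k = 0 then 0 else - ((-1) ^ k * (\<beta> gchoose k)))" for k :: nat
  have p_nonneg: "0 \<le> p k" for k
    using sibuya_coeff_nonneg[OF \<beta>, of "k - 1"] by (cases k) (auto simp: p_def)
  have sums: "(\<lambda>k. p k * z ^ k) sums (1 - (1 - z) powr \<beta>)" if "0 \<le> z" "z < 1" for z
  proof -
    have "(\<lambda>k. (if k = 0 then 1 else 0) - (\<beta> gchoose k) * (- z) ^ k) sums (1 - (1 + - z) powr \<beta>)"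
      using that by (intro sums_diff gen_binomial_real sums_single[of 0 "\<lambda>_. 1"]) auto
    moreover have "(if k = 0 then 1 else 0) - (\<beta> gchoose k) * (- z) ^ k = p k * z ^ k" for k
      by (auto simp: p_def power_minus[of z])
    ultimately show ?thesis by simp
  qed
  \<comment> \<open>The series is known only for z < 1, so the total mass is found by letting z tend
    to 1 from the left. A partial sum is a polynomial in z and passes to the limit directly.\<close>
  have part: "(\<Sum>k<n. p k) \<le> 1" for n
  proof (rule tendsto_le)
    show "((\<lambda>z. \<Sum>k<n. p k * z ^ k) \<longlongrightarrow> (\<Sum>k<n. p k)) (at_left 1)"
      by (rule tendsto_eq_intros | simp)+
    show "\<forall>\<^sub>F z in at_left 1. (\<Sum>k<n. p k * z ^ k) \<le> (1::real)"
      using eventually_at_left_real[of 0 "1::real"]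
    proof (rule eventually_mono)
      fix z :: real assume z: "z \<in> {0<..<1}"
      have "(\<Sum>k<n. p k * z ^ k) \<le> 1 - (1 - z) powr \<beta>"
        using sums[of z] z p_nonneg by (subst sums_unique[of _ "1 - (1 - z) powr \<beta>"])
          (auto intro!: sum_le_suminf simp: sums_iff)
      then show "(\<Sum>k<n. p k * z ^ k) \<le> 1" by (smt (verit) powr_ge_zero)
    qed simp
  qed auto
  have summ: "summable p"
    using p_nonneg part by (rule summableI_nonneg_bounded)
  \<comment> \<open>Conversely, \<open>p k * z ^ k \<le> p k\<close> bounds the value of the series
    by \<open>suminf p\<close>, and that value tends to 1.\<close>
  have "1 \<le> suminf p"
  proof (rule tendsto_le)
    show "((\<lambda>z::real. 1 - (1 - z) powr \<beta>) \<longlongrightarrow> 1) (at_left 1)"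
      using \<beta> by real_asymp
    show "\<forall>\<^sub>F z in at_left 1. 1 - (1 - z) powr \<beta> \<le> suminf p"
      using eventually_at_left_real[of 0 "1::real"]
    proof (rule eventually_mono)
      fix z :: real assume z: "z \<in> {0<..<1}"
      show "1 - (1 - z) powr \<beta> \<le> suminf p"
        by (rule sums_le[OF _ sums summable_sums[OF summ]])
           (use z p_nonneg in \<open>auto intro!: mult_left_le power_le_one\<close>)
    qed simp
  qed auto
  moreover have "suminf p \<le> 1" using summ part by (rule suminf_le_const)
  ultimately have "suminf p = 1" by simp
  then have total: "(\<integral>\<^sup>+k. ennreal (p k) \<partial>count_space UNIV) = 1"
    using p_nonneg summ by (simp add: nn_integral_count_space_nat suminf_ennreal2)
  define q where "q = embed_pmf p"
  have q: "pmf q k = p k" for k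
    unfolding q_def by (rule pmf_embed_pmf[OF p_nonneg total])
  have "has_laplace (distr q borel real) (\<lambda>u. 1 - (1 - exp (- u)) powr \<beta>)"
  proof (rule has_laplaceI)
    fix u :: real assume u: "0 \<le> u"
    have "(1 - exp (- u)) powr \<beta> \<le> 1"
      using u \<beta> by (intro powr_le1) auto
    then show "0 \<le> 1 - (1 - exp (- u)) powr \<beta>" by simp
    show "(\<integral>\<^sup>+x. ennreal (exp (- (u * x))) \<partial>distr q borel real) = ennreal (1 - (1 - exp (- u)) powr \<beta>)"
    \<comment> \<open>At \<open>u = 0\<close> the point z = exp(-u) = 1 is outside the range of
      \<open>sums\<close>; there the claim is that the total mass is 1, as
      \<open>0 powr \<beta>\<close> is 0.\<close>
    proof (cases "u = 0")
      case True
      then show ?thesis by (simp add: emeasure_distr measure_pmf.emeasure_eq_measure)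
    next
      case False
      have "(\<integral>\<^sup>+x. ennreal (exp (- (u * x))) \<partial>distr q borel real)
          = (\<integral>\<^sup>+k. ennreal (p k) * ennreal (exp (- (u * real k))) \<partial>count_space UNIV)"
        by (simp add: nn_integral_distr nn_integral_measure_pmf q)
      also have "\<dots> = (\<Sum>k. ennreal (p k * exp (- u) ^ k))"
        by (simp add: nn_integral_count_space_nat p_nonneg mult.commute
            flip: ennreal_mult exp_of_nat_mult)
      also have "\<dots> = ennreal (1 - (1 - exp (- u)) powr \<beta>)"
        using sums[of "exp (- u)"] u False p_nonneg
        by (subst suminf_ennreal_eq) auto
      finally show ?thesis .
    qed
  qed (auto simp: AE_distr_iff intro!: prob_space.prob_space_distr prob_space_measure_pmf)
  then show ?thesis by blast
qed

text \<open>For e = u n^(-1/\<beta>), the quantity (1 - exp(-e))^\<beta> is asymptotic to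
  u^\<beta>/n, so the n-th power of 1 minus it tends to exp(-u^\<beta>).\<close>

lemma has_laplace_stable:
  fixes \<beta> :: real
  assumes \<beta>: "0 < \<beta>" "\<beta> \<le> 1"
  shows "\<exists>M. has_laplace M (\<lambda>u. exp (- (u powr \<beta>)))"
proof -
  obtain S where S: "has_laplace S (\<lambda>u. 1 - (1 - exp (- u)) powr \<beta>)"
    using has_laplace_sibuya[OF \<beta>] by blast
  define L where "L n u = (1 - (1 - exp (- (u * real n powr (- (1/\<beta>))))) powr \<beta>) ^ n" for n u
  have "\<exists>M. has_laplace M (L n)" for n
    using has_laplace_power[OF has_laplace_scale[OF S, of "real n powr (- (1/\<beta>))"], of n]
    by (simp add: L_def[abs_def])
  then obtain M where M: "\<And>n. has_laplace (M n) (L n)" by metis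
  \<comment> \<open>A bound uniform in \<open>n\<close>, for the equicontinuity at 0: 1 - exp(-e)
    \<le> e bounds the summed deficits by \<open>d powr \<beta>\<close>, and Bernoulli's inequality
    passes to the n-th power.\<close>
  have lower: "1 - L n d \<le> d powr \<beta>" if "0 \<le> d" for n d
  proof (cases "n = 0")
    case False
    define e where "e = d * real n powr (- (1/\<beta>))"
    have e: "0 \<le> e" using that by (simp add: e_def)
    have "(1 - exp (- e)) powr \<beta> \<le> e powr \<beta>"
      using \<beta> e exp_ge_add_one_self[of "- e"] by (intro powr_mono2) auto
    also have "e powr \<beta> = d powr \<beta> / real n"
      using that \<beta> False by (simp add: e_def powr_mult powr_divide powr_powr powr_minus_divide)
    finally have le: "real n * (1 - exp (- e)) powr \<beta> \<le> d powr \<beta>"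
      using False by (simp add: field_simps)
    have "(1 - exp (- e)) powr \<beta> \<le> 1" using e \<beta> by (intro powr_le1) auto
    then have "1 + real n * (- ((1 - exp (- e)) powr \<beta>)) \<le> (1 + (- ((1 - exp (- e)) powr \<beta>))) ^ n"
      by (intro Bernoulli_inequality) auto
    then show ?thesis using le by (simp add: L_def e_def)
  qed (simp add: L_def)
  show ?thesis
  proof (rule has_laplace_limit[OF M])
    fix \<epsilon> :: real assume \<epsilon>: "0 < \<epsilon>"
    \<comment> \<open>Chosen so that \<open>d powr \<beta>\<close> equals \<epsilon>/2.\<close>
    define d where "d = (\<epsilon> / 2) powr (1/\<beta>)"
    have "d powr \<beta> < \<epsilon>" using \<epsilon> \<beta> by (simp add: d_def powr_powr)
    moreover have "0 < d" using \<epsilon> by (simp add: d_def)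
    ultimately show "\<exists>d>0. \<forall>n. 1 - L n d < \<epsilon>"
      using lower[of d] by (intro exI[of _ d]) (auto intro: le_less_trans)
  next
    fix u :: real assume "0 \<le> u"
    then consider "u = 0" | "0 < u" by linarith
    then show "(\<lambda>n. L n u) \<longlonglongrightarrow> exp (- (u powr \<beta>))"
    proof cases
      case 2
      then show ?thesis unfolding L_def using \<beta> by real_asymp
    qed (simp add: L_def)
  qed
qed

text \<open>An atom at 0 contributes its full mass to \<open>L u\<close> for every \<open>u\<close>,
  so decay at infinity excludes it. Strict positivity later permits division by the stable
  variable.\<close>

lemma has_laplace_AE_pos:
  assumes M: "has_laplace M L" and lim: "(L \<longlongrightarrow> 0) at_top"
  shows "AE x in M. 0 < x"
proof -
  note D = has_laplaceD[OF M]
  interpret real_distribution M by fact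
  have "measure M {0} \<le> 0"
  proof (rule tendsto_lowerbound[OF lim])
    show "\<forall>\<^sub>F u in at_top. measure M {0} \<le> L u"
      using eventually_ge_at_top[of 0]
    proof eventually_elim
      case (elim u)
      have "emeasure M {0} = (\<integral>\<^sup>+x. indicator {0} x \<partial>M)" by simp
      also have "\<dots> \<le> (\<integral>\<^sup>+x. ennreal (exp (- (u * x))) \<partial>M)"
        by (intro nn_integral_mono) (auto simp: indicator_def)
      finally show ?case using D(6,7)[OF elim] by (simp add: emeasure_eq_measure)
    qed
  qed simp
  then have "emeasure M {0} = 0" by (simp add: emeasure_eq_measure measure_le_0_iff)
  then have "AE x in M. x \<noteq> 0" by (subst AE_iff_measurable[of "{0}"]) auto
  with D(5) show ?thesis by eventually_elim auto
qed

section \<open>Gamma-type integrals\<close>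

text \<open>Substitute z^(-1/p) v for v: the exponent becomes v^p, and the powers of z from dv and
  v^(a-1) combine to z^(-a/p).\<close>

lemma nn_integral_powr_exp_scale:
  fixes a p z :: real
  assumes "0 < p" "0 < z"
  shows "(\<integral>\<^sup>+v. ennreal (indicator {0<..} v * v powr (a - 1) * exp (- (z * v powr p))) \<partial>lborel)
    = ennreal (z powr (- (a / p))) *
      (\<integral>\<^sup>+v. ennreal (indicator {0<..} v * v powr (a - 1) * exp (- (v powr p))) \<partial>lborel)"
proof -
  define c where "c = z powr (- (1 / p))"
  have c: "0 < c" using assms by (simp add: c_def)
  have cp: "c powr p = 1 / z" using assms by (simp add: c_def powr_divide powr_powr powr_minus_divide)
  have ca: "c * c powr (a - 1) = z powr (- (a / p))"
    using c by (simp add: powr_mult_base) (simp add: c_def powr_powr)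
  have "(\<integral>\<^sup>+v. ennreal (indicator {0<..} v * v powr (a - 1) * exp (- (z * v powr p))) \<partial>lborel)
    = ennreal c * (\<integral>\<^sup>+v. ennreal (indicator {0<..} (0 + c * v) * (0 + c * v) powr (a - 1) *
        exp (- (z * (0 + c * v) powr p))) \<partial>lborel)"
    using c by (subst nn_integral_real_affine[of _ c 0]) auto
  also have "(\<integral>\<^sup>+v. ennreal (indicator {0<..} (0 + c * v) * (0 + c * v) powr (a - 1) *
        exp (- (z * (0 + c * v) powr p))) \<partial>lborel)
    = (\<integral>\<^sup>+v. ennreal (c powr (a - 1)) *
        ennreal (indicator {0<..} v * v powr (a - 1) * exp (- (v powr p))) \<partial>lborel)"
    using c assms
    by (intro nn_integral_cong)
       (auto simp: indicator_def powr_mult cp zero_less_mult_iff simp flip: ennreal_mult)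
  also have "ennreal c * \<dots> = ennreal (c * c powr (a - 1)) *
      (\<integral>\<^sup>+v. ennreal (indicator {0<..} v * v powr (a - 1) * exp (- (v powr p))) \<partial>lborel)"
    using c by (simp add: nn_integral_cmult ennreal_mult mult.assoc)
  finally show ?thesis unfolding ca .
qed

text \<open>The value is Gamma(a/p)/p. Finiteness comes from comparison with the Gamma integral
  through v - 1 \<le> v^p, positivity from the integrand being positive on (0,1).\<close>

lemma nn_integral_powr_exp_finite_pos:
  fixes a p :: real
  assumes a: "0 < a" and p: "1 \<le> p"
  shows "\<exists>J>0. (\<integral>\<^sup>+v. ennreal (indicator {0<..} v * v powr (a - 1) * exp (- (v powr p))) \<partial>lborel)
    = ennreal J"
proof -
  let ?I = "\<integral>\<^sup>+v. ennreal (indicator {0<..} v * v powr (a - 1) * exp (- (v powr p))) \<partial>lborel"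
  have "?I \<le> (\<integral>\<^sup>+v. ennreal (exp 1) * ennreal (indicator {0..} v * v powr (a - 1) / exp v) \<partial>lborel)"
  proof (intro nn_integral_mono)
    fix v :: real
    show "ennreal (indicator {0<..} v * v powr (a - 1) * exp (- (v powr p)))
      \<le> ennreal (exp 1) * ennreal (indicator {0..} v * v powr (a - 1) / exp v)"
    proof (cases "0 < v")
      case True
      have "v - 1 \<le> v powr p"
      proof (cases "1 \<le> v")
        case True
        then have "v powr 1 \<le> v powr p" using p by (intro powr_mono) auto
        then show ?thesis using True by simp
      next
        case False
        then show ?thesis by (smt (verit) powr_ge_zero)
      qed
      then have "exp (- (v powr p)) \<le> exp 1 / exp v" by (simp flip: exp_diff)
      then have "v powr (a - 1) * exp (- (v powr p)) \<le> v powr (a - 1) * (exp 1 / exp v)"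
        by (intro mult_left_mono) auto
      with True show ?thesis by (simp add: mult.commute flip: ennreal_mult)
    qed simp
  qed
  also have "\<dots> = ennreal (exp 1) * ennreal (Gamma a)"
    by (subst nn_integral_cmult) (simp_all add: Gamma_conv_nn_integral_real[OF a])
  also have "\<dots> < \<infinity>" by (simp add: ennreal_mult_less_top)
  finally have fin: "?I < \<infinity>" .
  have "?I \<noteq> 0"
  proof
    assume "?I = 0"
    then have "AE v in lborel. ennreal (indicator {0<..} v * v powr (a - 1) * exp (- (v powr p))) = 0"
      by (subst (asm) nn_integral_0_iff_AE) auto
    then have "AE v in lborel. v \<notin> {0<..<1::real}"
    proof eventually_elim
      case (elim v)
      then show ?case by (cases "0 < v") (auto simp: ennreal_eq_0_iff mult_le_0_iff not_le)
    qed
    then have "emeasure lborel {0<..<1::real} = 0"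
      by (subst (asm) AE_iff_measurable[of "{0<..<1}"]) auto
    then show False by simp
  qed
  with fin show ?thesis
    by (intro exI[of _ "enn2real ?I"]) (auto simp: enn2real_positive_iff less_top zero_less_iff_neq_zero)
qed

section \<open>The mixing kernel for powers\<close>

text \<open>\<open>\<kappa>\<close> is the law of \<open>Y / X\<close> under the measure with density proportional to \<open>X^(-\<alpha> \<beta>)\<close>.\<close>
lemma powr_kernel:
  fixes \<alpha> \<beta> :: real
  assumes \<alpha>: "0 < \<alpha>" and \<beta>: "0 < \<beta>" "\<beta> \<le> 1"
  obtains \<kappa> :: "real measure" where "prob_space \<kappa>" "sets \<kappa> = sets borel" "AE r in \<kappa>. 0 \<le> r"
    "\<And>s t. 0 < s \<Longrightarrow> 0 \<le> t \<Longrightarrow>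
      (\<integral>\<^sup>+r. ennreal ((s + t powr (1/\<beta>) * r) powr (- (\<alpha> * \<beta>))) \<partial>\<kappa>) = ennreal ((s powr \<beta> + t) powr (- \<alpha>))"
proof -
  obtain P where P: "has_laplace P (\<lambda>u. exp (- (u powr \<beta>)))"
    using has_laplace_stable[OF \<beta>] by blast
  note D = has_laplaceD[OF P]
  interpret P: prob_space P by fact
  interpret PP: pair_prob_space P P ..
  have [measurable_cong]: "sets P = sets borel" by fact
  have "((\<lambda>u. exp (- (u powr \<beta>))) \<longlongrightarrow> 0) at_top" using \<beta> by real_asymp
  from has_laplace_AE_pos[OF P this] have Ppos: "AE x in P. 0 < x" .
  have pos: "AE z in P \<Otimes>\<^sub>M P. 0 < fst z \<and> 0 < snd z"
  proof (rule PP.AE_pair_measure)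
    show "AE x in P. AE y in P. 0 < fst (x, y) \<and> 0 < snd (x, y)"
      using Ppos
    proof eventually_elim
      case (elim x)
      show ?case using Ppos by eventually_elim (use elim in auto)
    qed
  qed measurable
  define h where "h p v = indicator {0<..} v * v powr (\<alpha> - 1) * exp (- (v powr p))" for p v :: real
  \<comment> \<open>\<open>J\<close> arises from the v-integral with exponent 1/\<beta>,
    \<open>G\<close> from the one with exponent 1; the constant C in the average of kernels is
    \<open>J / G\<close>.\<close>
  obtain J where J: "0 < J" "(\<integral>\<^sup>+v. ennreal (h (1/\<beta>) v) \<partial>lborel) = ennreal J"
    using nn_integral_powr_exp_finite_pos[OF \<alpha>, of "1/\<beta>"] \<beta> unfolding h_def by auto
  obtain G where G: "0 < G" "(\<integral>\<^sup>+v. ennreal (h 1 v) \<partial>lborel) = ennreal G"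
    using nn_integral_powr_exp_finite_pos[OF \<alpha>, of 1] unfolding h_def by auto
  define H where "H s \<tau> z = (s * fst z + \<tau> * snd z) powr (- (\<alpha> * \<beta>))" for s \<tau> :: real and z :: "real \<times> real"
  have [measurable]: "H s \<tau> \<in> borel_measurable (P \<Otimes>\<^sub>M P)" for s \<tau>
    unfolding H_def by measurable
  \<comment> \<open>Both sides evaluate one double integral: integrating over v first gives the left
    side by scaling, integrating over the stable pair first gives the right side through the Laplace
    transforms.\<close>
  have key: "ennreal J * (\<integral>\<^sup>+z. ennreal (H s (t powr (1/\<beta>)) z) \<partial>(P \<Otimes>\<^sub>M P))
      = ennreal G * ennreal ((s powr \<beta> + t) powr (- \<alpha>))"
    if s: "0 < s" and t: "0 \<le> t" for s t
  proof -
    define \<tau> where "\<tau> = t powr (1/\<beta>)"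
    have \<tau>: "0 \<le> \<tau>" "\<tau> powr \<beta> = t" using t \<beta> by (auto simp: \<tau>_def powr_powr)
    have "ennreal J * (\<integral>\<^sup>+z. ennreal (H s \<tau> z) \<partial>(P \<Otimes>\<^sub>M P))
        = (\<integral>\<^sup>+z. ennreal (H s \<tau> z) * ennreal J \<partial>(P \<Otimes>\<^sub>M P))"
      by (subst nn_integral_multc) (auto simp: mult.commute)
    also have "\<dots> = (\<integral>\<^sup>+z. \<integral>\<^sup>+v. ennreal (indicator {0<..} v * v powr (\<alpha> - 1) *
        exp (- ((s * fst z + \<tau> * snd z) * v powr (1/\<beta>)))) \<partial>lborel \<partial>(P \<Otimes>\<^sub>M P))"
    proof (rule nn_integral_cong_AE)
      show "AE z in P \<Otimes>\<^sub>M P. ennreal (H s \<tau> z) * ennreal J =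
        (\<integral>\<^sup>+v. ennreal (indicator {0<..} v * v powr (\<alpha> - 1) *
          exp (- ((s * fst z + \<tau> * snd z) * v powr (1/\<beta>)))) \<partial>lborel)"
        using pos
      proof eventually_elim
        case (elim z)
        then have "0 < s * fst z + \<tau> * snd z" using s \<tau> by (intro add_pos_nonneg) auto
        then show ?case
          using \<beta> J(2) by (subst nn_integral_powr_exp_scale) (auto simp: H_def h_def)
      qed
    qed
    also have "\<dots> = (\<integral>\<^sup>+v. \<integral>\<^sup>+z. ennreal (indicator {0<..} v * v powr (\<alpha> - 1) *
        exp (- ((s * fst z + \<tau> * snd z) * v powr (1/\<beta>)))) \<partial>(P \<Otimes>\<^sub>M P) \<partial>lborel)"
    proof -
      interpret Q: pair_sigma_finite "P \<Otimes>\<^sub>M P" lborel ..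
      show ?thesis by (rule Q.Fubini'[symmetric]) measurable
    qed
    also have "\<dots> = (\<integral>\<^sup>+v. ennreal (indicator {0<..} v * v powr (\<alpha> - 1) *
        exp (- ((s powr \<beta> + t) * v powr 1))) \<partial>lborel)"
    proof (intro nn_integral_cong)
      fix v :: real
      show "(\<integral>\<^sup>+z. ennreal (indicator {0<..} v * v powr (\<alpha> - 1) *
          exp (- ((s * fst z + \<tau> * snd z) * v powr (1/\<beta>)))) \<partial>(P \<Otimes>\<^sub>M P))
        = ennreal (indicator {0<..} v * v powr (\<alpha> - 1) * exp (- ((s powr \<beta> + t) * v powr 1)))"
      proof (cases "0 < v")
        case v: True
        \<comment> \<open>With w^\<beta> = v and \<tau>^\<beta> = t, the transforms at
          \<open>s * w\<close> and \<open>\<tau> * w\<close> have exponents s^\<beta> v and t v,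
          linear in v.\<close>
        define w where "w = v powr (1/\<beta>)"
        have w: "0 \<le> w" "w powr \<beta> = v" using v \<beta> by (auto simp: w_def powr_powr)
        have "(\<integral>\<^sup>+z. ennreal (indicator {0<..} v * v powr (\<alpha> - 1) *
            exp (- ((s * fst z + \<tau> * snd z) * w))) \<partial>(P \<Otimes>\<^sub>M P))
          = (\<integral>\<^sup>+z. ennreal (v powr (\<alpha> - 1)) * (ennreal (exp (- (s * w * fst z))) *
              ennreal (exp (- (\<tau> * w * snd z)))) \<partial>(P \<Otimes>\<^sub>M P))"
          using v by (intro nn_integral_cong)
            (auto simp: algebra_simps simp flip: ennreal_mult exp_add)
        also have "\<dots> = ennreal (v powr (\<alpha> - 1)) * (\<integral>\<^sup>+z. (ennreal (exp (- (s * w * fst z))) *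
              ennreal (exp (- (\<tau> * w * snd z)))) \<partial>(P \<Otimes>\<^sub>M P))"
          by (subst nn_integral_cmult) auto
        also have "(\<integral>\<^sup>+z. (ennreal (exp (- (s * w * fst z))) *
              ennreal (exp (- (\<tau> * w * snd z)))) \<partial>(P \<Otimes>\<^sub>M P))
          = (\<integral>\<^sup>+x. \<integral>\<^sup>+y. ennreal (exp (- (s * w * x))) * ennreal (exp (- (\<tau> * w * y))) \<partial>P \<partial>P)"
          by (subst P.nn_integral_fst[symmetric]) auto
        also have "\<dots> = ennreal (exp (- ((s * w) powr \<beta>))) * ennreal (exp (- ((\<tau> * w) powr \<beta>)))"
          using D(7)[of "s * w"] D(7)[of "\<tau> * w"] s \<tau> w
          by (simp add: nn_integral_cmult nn_integral_multc)
        also have "\<dots> = ennreal (exp (- ((s powr \<beta> + t) * v)))"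
          using s \<tau> w by (simp add: powr_mult algebra_simps flip: ennreal_mult exp_add)
        finally show ?thesis using v by (simp add: w_def flip: ennreal_mult)
      qed simp
    qed
    also have "\<dots> = ennreal ((s powr \<beta> + t) powr (- \<alpha>)) * ennreal G"
      using s t G(2) by (subst nn_integral_powr_exp_scale) (auto simp: h_def intro!: add_pos_nonneg)
    finally show ?thesis by (simp add: \<tau>_def mult.commute)
  qed
  \<comment> \<open>For z = (X, Y), (s X + \<tau> Y)^(-\<alpha> \<beta>) splits into X^(-\<alpha>
    \<beta>) and (s + \<tau> Y/X)^(-\<alpha> \<beta>). The density carries the first factor and the
    constant \<open>J / G\<close>.\<close>
  define \<kappa> where "\<kappa> = distr (density (P \<Otimes>\<^sub>M P) (\<lambda>z. ennreal (J / G * fst z powr (- (\<alpha> * \<beta>)))))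
    borel (\<lambda>z. snd z / fst z)"
  have sets: "sets \<kappa> = sets borel" by (simp add: \<kappa>_def)
  have int: "(\<integral>\<^sup>+r. ennreal ((s + t powr (1/\<beta>) * r) powr (- (\<alpha> * \<beta>))) \<partial>\<kappa>) = ennreal ((s powr \<beta> + t) powr (- \<alpha>))"
    if s: "0 < s" and t: "0 \<le> t" for s t
  proof -
    define \<tau> where "\<tau> = t powr (1/\<beta>)"
    have \<tau>: "0 \<le> \<tau>" by (simp add: \<tau>_def)
    have "(\<integral>\<^sup>+r. ennreal ((s + \<tau> * r) powr (- (\<alpha> * \<beta>))) \<partial>\<kappa>)
      = (\<integral>\<^sup>+z. ennreal (J / G * fst z powr (- (\<alpha> * \<beta>))) *
          ennreal ((s + \<tau> * (snd z / fst z)) powr (- (\<alpha> * \<beta>))) \<partial>(P \<Otimes>\<^sub>M P))"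
      unfolding \<kappa>_def by (simp add: nn_integral_distr nn_integral_density)
    also have "\<dots> = (\<integral>\<^sup>+z. ennreal (1 / G) * (ennreal J * ennreal (H s \<tau> z)) \<partial>(P \<Otimes>\<^sub>M P))"
    proof (rule nn_integral_cong_AE)
      show "AE z in P \<Otimes>\<^sub>M P. ennreal (J / G * fst z powr (- (\<alpha> * \<beta>))) *
          ennreal ((s + \<tau> * (snd z / fst z)) powr (- (\<alpha> * \<beta>)))
          = ennreal (1 / G) * (ennreal J * ennreal (H s \<tau> z))"
        using pos
      proof eventually_elim
        case (elim z)
        have "H s \<tau> z = (fst z * (s + \<tau> * (snd z / fst z))) powr (- (\<alpha> * \<beta>))"
          using elim by (simp add: H_def distrib_left mult.commute mult.left_commute)
        also have "\<dots> = fst z powr (- (\<alpha> * \<beta>)) * (s + \<tau> * (snd z / fst z)) powr (- (\<alpha> * \<beta>))"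
          using elim s \<tau> by (intro powr_mult) 
        finally show ?case using J(1) G(1) by (simp flip: ennreal_mult)
      qed
    qed
    also have "\<dots> = ennreal (1 / G) * (ennreal G * ennreal ((s powr \<beta> + t) powr (- \<alpha>)))"
      using key[OF s t] by (simp add: nn_integral_cmult \<tau>_def)
    also have "\<dots> = ennreal ((s powr \<beta> + t) powr (- \<alpha>))"
      using G(1) by (simp flip: ennreal_mult)
    finally show ?thesis by (simp add: \<tau>_def)
  qed
  \<comment> \<open>For s = 1 and t = 0 the integrand is constantly 1, so the kernel identity itself
    gives the total mass.\<close>
  have "emeasure \<kappa> (space \<kappa>) = 1" using int[of 1 0] by simp
  then have "prob_space \<kappa>" by (rule prob_spaceI)
  moreover have "AE r in \<kappa>. 0 \<le> r"
  proof -
    have "AE z in P \<Otimes>\<^sub>M P. 0 \<le> snd z / fst z" using pos by eventually_elim simp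
    then show ?thesis unfolding \<kappa>_def by (subst AE_distr_iff) (auto simp: AE_density)
  qed
  ultimately show ?thesis using that sets int by blast
qed

section \<open>Transfer to the Stieltjes classes\<close>

text \<open>Integrating the kernel identity over \<open>\<mu>\<close> turns the transform of
  \<open>\<mu>\<close> at s^\<beta> into the transform of order \<alpha> \<beta> of the image of the
  product of \<open>\<mu>\<close> and \<open>\<kappa>\<close> under (t, r) -> t^(1/\<beta>) r. The
  constant \<open>a\<close> is kept.\<close>

lemma S_class_powr:
  fixes \<alpha> \<beta> :: real
  assumes \<alpha>: "0 < \<alpha>" and \<beta>: "0 < \<beta>" "\<beta> \<le> 1" and f: "f \<in> S_class \<alpha>"
  shows "(\<lambda>s. f (s powr \<beta>)) \<in> S_class (\<alpha> * \<beta>)"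
proof -
  from f obtain a \<mu> where a: "0 \<le> a" and \<mu>: "\<mu> \<in> M_plus \<alpha>"
    and f_eq: "\<And>z. 0 < z \<Longrightarrow> f z = a + Stieltjes_transform \<alpha> \<mu> z"
    by (auto simp: S_class_def)
  have [measurable_cong]: "sets \<mu> = sets borel" and neg: "emeasure \<mu> {..<0} = 0"
    and fin: "(\<integral>\<^sup>+t. ennreal ((1 + t) powr (-\<alpha>)) \<partial>\<mu>) < \<infinity>"
    using \<mu> by (auto simp: M_plus_def)
  have \<mu>_pos: "AE t in \<mu>. 0 \<le> t"
    using neg sets_eq_imp_space_eq[OF \<open>sets \<mu> = sets borel\<close>]
    by (subst AE_iff_measurable[of "{..<0}"]) (auto simp: not_le)
  obtain \<kappa> :: "real measure" where \<kappa>: "prob_space \<kappa>" "sets \<kappa> = sets borel" "AE r in \<kappa>. 0 \<le> r"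
    and int: "\<And>s t. 0 < s \<Longrightarrow> 0 \<le> t \<Longrightarrow>
      (\<integral>\<^sup>+r. ennreal ((s + t powr (1/\<beta>) * r) powr (- (\<alpha> * \<beta>))) \<partial>\<kappa>) = ennreal ((s powr \<beta> + t) powr (- \<alpha>))"
    using powr_kernel[OF \<alpha> \<beta>] by metis
  interpret \<kappa>: prob_space \<kappa> by fact
  have [measurable_cong]: "sets \<kappa> = sets borel" by fact
  define \<nu> where "\<nu> = distr (\<mu> \<Otimes>\<^sub>M \<kappa>) borel (\<lambda>z. fst z powr (1/\<beta>) * snd z)"
  have nn_\<nu>: "(\<integral>\<^sup>+x. g x \<partial>\<nu>) = (\<integral>\<^sup>+t. \<integral>\<^sup>+r. g (t powr (1/\<beta>) * r) \<partial>\<kappa> \<partial>\<mu>)"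
    if [measurable]: "g \<in> borel_measurable borel" for g
    unfolding \<nu>_def by (subst nn_integral_distr) (simp_all flip: \<kappa>.nn_integral_fst)
  have trans: "(\<integral>\<^sup>+x. ennreal ((s + x) powr (- (\<alpha> * \<beta>))) \<partial>\<nu>)
      = (\<integral>\<^sup>+t. ennreal ((s powr \<beta> + t) powr (- \<alpha>)) \<partial>\<mu>)" if s: "0 < s" for s
  proof -
    have "AE t in \<mu>. (\<integral>\<^sup>+r. ennreal ((s + t powr (1/\<beta>) * r) powr (- (\<alpha> * \<beta>))) \<partial>\<kappa>)
        = ennreal ((s powr \<beta> + t) powr (- \<alpha>))"
      using \<mu>_pos by eventually_elim (rule int[OF s])
    then show ?thesis by (simp add: nn_\<nu> cong: nn_integral_cong_AE)
  qed
  have "\<nu> \<in> M_plus (\<alpha> * \<beta>)"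
  proof -
    have "emeasure \<nu> {..<0} = (\<integral>\<^sup>+x. indicator {..<0} x \<partial>\<nu>)" by (simp add: \<nu>_def)
    also have "\<dots> = (\<integral>\<^sup>+t. \<integral>\<^sup>+r. indicator {..<0} (t powr (1/\<beta>) * r) \<partial>\<kappa> \<partial>\<mu>)"
      by (rule nn_\<nu>) auto
    also have "\<dots> = (\<integral>\<^sup>+t. \<integral>\<^sup>+r. 0 \<partial>\<kappa> \<partial>\<mu>)"
    proof (rule nn_integral_cong, rule nn_integral_cong_AE)
      fix t :: real
      show "AE r in \<kappa>. indicator {..<0} (t powr (1/\<beta>) * r) = (0::ennreal)"
        using \<kappa>(3) by eventually_elim (auto simp: indicator_def not_less)
    qed
    \<comment> \<open>At s = 1, \<open>trans\<close> equates the moment integral of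
      \<open>\<nu>\<close> of order \<alpha> \<beta> with that of \<open>\<mu>\<close> of order
      \<alpha>.\<close>
    finally show ?thesis using trans[of 1] fin by (simp add: M_plus_def \<nu>_def)
  qed
  moreover have "f (s powr \<beta>) = a + Stieltjes_transform (\<alpha> * \<beta>) \<nu> s" if s: "0 < s" for s
  proof -
    have [measurable_cong]: "sets \<nu> = sets borel" by (simp add: \<nu>_def)
    \<comment> \<open>Both integrands are nonnegative, so each Bochner integral is the real value of
      its nonnegative integral, and \<open>trans\<close> equates these.\<close>
    have "Stieltjes_transform (\<alpha> * \<beta>) \<nu> s = Stieltjes_transform \<alpha> \<mu> (s powr \<beta>)"
      unfolding Stieltjes_transform_def
      by (simp add: integral_eq_nn_integral trans[OF s])
    then show ?thesis using f_eq[of "s powr \<beta>"] s by simp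
  qed
  ultimately show ?thesis using a by (auto simp: S_class_def)
qed

theorem theorem6p7:
  fixes \<alpha> \<beta> :: real and f :: "real \<Rightarrow> real"
  assumes "\<alpha> > 0" and "0 < \<beta>" and "\<beta> \<le> 1" and "f \<in> S_class \<alpha>"
  shows "(\<lambda>s. f (s powr \<beta>)) \<in> S_class (\<alpha> * \<beta>) \<and>
         (\<forall>g. g \<in> S_class 1 \<longrightarrow> (\<lambda>s. g (s powr \<beta>)) \<in> S_class \<beta>)"
  using S_class_powr[OF assms] S_class_powr[OF zero_less_one assms(2,3)] by auto

end
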